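(* Let $G$ and $H$ be connected graphs, each with at least two vertices. (i) If $pc(G),pc(H)\geq 2$, then $pc(G\circ H)\leq pc(H)$ if $pc(G)>pc(H)$; $pc(G\circ H)\leq pc(G)+1$ if $pc(G)<pc(H)$; and $pc(G\circ H)\leq pc(G)$ if $pc(G)=pc(H)$. (ii) If $pc(G)=1$ and $pc(H)\geq 2$, then $pc(G\circ H)=2$. (iii) If $pc(H)=1$ and $pc(G)\geq 2$, then $pc(G\circ H)=2$. (iv) If $pc(G)=1$ and $pc(H)=1$, then $pc(G\circ H)=1$. Moreover, the bound is sharp.
   Context: All graphs are simple, finite and undirected. In an edge-colored graph (adjacent edges may receive the same color), a path is a proper path if no two adjacent edges of the path have the same color. The proper connection number $pc(G)$ of a connected graph $G$ is the minimum number of colors in an edge-coloring of $G$ such that every two distinct vertices are joined by a proper path. The lexicographic product $G\circ H$ has vertex set $V(G)\times V(H)$, with $(g,h)$ adjacent to $(g',h')$ iff $gg'\in E(G)$, or $g=g'$ and $hh'\in E(H)$.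
   Formalization: Sharpness is asserted only for the cases pc(G)>pc(H) and pc(G)=pc(H) of (i); for pc(G)<pc(H) the bound pc(G)+1≥3 is never attained, since pc(G∘H)=2 whenever pc(G),pc(H)≥2, so sharpness in that case is omitted. *)

theory Defs
  imports "Graph_Theory.Digraph_Component"
begin

text \<open>
  A finite simple undirected graph is a \<^locale>\<open>pair_graph\<close>: each undirected edge is
  represented by its two opposite arcs. Colours are therefore assigned to the
  two-element sets of end vertices, so that both arcs of an edge share one colour.
\<close>

definition edges_of :: "'a pair_pre_digraph \<Rightarrow> 'a set set" where
  "edges_of G = (\<lambda>(u, v). {u, v}) ` parcs G"

text \<open>
  A path visits no vertex twice, so two of its edges are adjacent exactly if they are
  consecutive.
\<close>

definition proper_path ::
  "'a pair_pre_digraph \<Rightarrow> ('a set \<Rightarrow> nat) \<Rightarrow> 'a \<Rightarrow> ('a \<times> 'a) awalk \<Rightarrow> 'a \<Rightarrow> bool" where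
  "proper_path G c u p v \<longleftrightarrow>
     pre_digraph.apath (with_proj G) u p v \<and> distinct_adj (map (\<lambda>(x, y). c {x, y}) p)"

definition proper_connected_coloring :: "'a pair_pre_digraph \<Rightarrow> ('a set \<Rightarrow> nat) \<Rightarrow> bool" where
  "proper_connected_coloring G c \<longleftrightarrow>
     (\<forall>u \<in> pverts G. \<forall>v \<in> pverts G. u \<noteq> v \<longrightarrow> (\<exists>p. proper_path G c u p v))"

text \<open>Only meaningful for connected graphs; otherwise the minimum is over the empty set.\<close>

definition pc :: "'a pair_pre_digraph \<Rightarrow> nat" where
  "pc G = (LEAST k. \<exists>c. proper_connected_coloring G c \<and> card (c ` edges_of G) = k)"

definition lexicographic_product ::
  "'a pair_pre_digraph \<Rightarrow> 'b pair_pre_digraph \<Rightarrow> ('a \<times> 'b) pair_pre_digraph" where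
  "lexicographic_product G H =
     \<lparr> pverts = pverts G \<times> pverts H,
       parcs = {((g, h), (g', h')) | g h g' h'.
         g \<in> pverts G \<and> h \<in> pverts H \<and> g' \<in> pverts G \<and> h' \<in> pverts H \<and>
         ((g, g') \<in> parcs G \<or> g = g' \<and> (h, h') \<in> parcs H)} \<rparr>"

definition nontrivial_connected_graph :: "'a pair_pre_digraph \<Rightarrow> bool" where
  "nontrivial_connected_graph G \<longleftrightarrow>
     pair_graph G \<and> Digraph_Component.connected (with_proj G) \<and> 2 \<le> card (pverts G)"

lemma pair_graph_lexicographic_product:
  assumes "pair_graph G" "pair_graph H"
  shows "pair_graph (lexicographic_product G H)"
proof -
  interpret G: pair_graph G by fact
  interpret H: pair_graph H by fact
  let ?L = "lexicographic_product G H"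
  have fin: "finite (pverts ?L)"
    using G.pair_finite_verts H.pair_finite_verts by (simp add: lexicographic_product_def)
  have sub: "parcs ?L \<subseteq> pverts ?L \<times> pverts ?L"
    by (auto simp: lexicographic_product_def)
  show ?thesis
  proof
    show "finite (parcs ?L)" using sub fin by (meson finite_SigmaI finite_subset)
    show "symmetric (with_proj ?L)"
      using G.arcs_symmetric H.arcs_symmetric
      by (auto simp: symmetric_def sym_def lexicographic_product_def)
    show "fst e \<noteq> snd e" if "e \<in> parcs ?L" for e
      using that G.no_loops' H.no_loops' by (auto simp: lexicographic_product_def)
  qed (use fin sub in auto)
qed

end

theory Submission
  imports Defs
begin

text \<open>
  In fact \<open>G \<circ> H\<close> always has proper connection number at most 2. Split the vertices of \<open>H\<close>
  into \<open>{h\<^sub>0}\<close> and the rest, call the class of \<open>h\<close> the bit of \<open>(g, h)\<close>, and colour an edge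
  of the product according to whether the bits of its ends agree. A walk in \<open>G\<close> lifts to an
  alternating walk by letting the bits run through the pattern \<open>b, b, \<not>b, \<not>b, b, \<dots>\<close>;
  positions two apart carry opposite bits, so going back and forth along the last edge of a
  path of \<open>G\<close> still lifts to a path, but ends with the opposite bit. Hence all pairs of
  vertices over distinct vertices of \<open>G\<close> are joined, and vertices in one fibre are joined by
  going back and forth along an edge of \<open>G\<close> once or twice. The value is 1 exactly for complete
  graphs, and the product is complete iff both factors are. Sharpness is witnessed by stars,
  since the star with \<open>n\<close> leaves has proper connection number \<open>n\<close>.
\<close>

section \<open>Walks as sequences of vertices\<close>

lemma pcas_map_upt:
  "pcas (f k) (map (\<lambda>i. (f i, f (Suc i))) [k..<k + m]) (f (k + m))"
proof (induction m arbitrary: k)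
  case (Suc m)
  show ?case using Suc[of "Suc k"] by (simp add: upt_conv_Cons del: upt_Suc)
qed simp

lemma pawalk_verts_map_upt:
  "pawalk_verts (f k) (map (\<lambda>i. (f i, f (Suc i))) [k..<k + m]) = map f [k..<Suc (k + m)]"
proof (induction m arbitrary: k)
  case (Suc m)
  show ?case using Suc[of "Suc k"] by (simp add: upt_conv_Cons del: upt_Suc)
qed simp

lemma nth_pcas:
  assumes "pcas u p v" "i < length p"
  shows "p ! i = (pawalk_verts u p ! i, pawalk_verts u p ! Suc i)"
  using assms
proof (induction p arbitrary: u i)
  case (Cons e p)
  then show ?case
    by (cases i; cases p) (auto simp: prod_eq_iff)
qed simp

lemma pawalk_verts_ends:
  assumes "pcas u p v"
  shows "pawalk_verts u p ! 0 = u" "pawalk_verts u p ! length p = v"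
  using assms by (induction p arbitrary: u) auto

lemma length_pawalk_verts: "length (pawalk_verts u p) = Suc (length p)"
  by (induction p arbitrary: u) auto

lemma apath_sequence:
  assumes "pre_digraph.apath (with_proj G) u p v"
  defines "f \<equiv> nth (pawalk_verts u p)"
  shows "f 0 = u" "f (length p) = v" "inj_on f {..length p}"
    and "\<And>i. i < length p \<Longrightarrow> p ! i = (f i, f (Suc i))"
    and "\<And>i. i < length p \<Longrightarrow> (f i, f (Suc i)) \<in> parcs G"
proof -
  have p: "set p \<subseteq> parcs G" "pcas u p v" "distinct (pawalk_verts u p)"
    using assms(1) by (auto simp: pre_digraph.apath_def pre_digraph.awalk_def
        cas_with_proj_eq awalk_verts_with_proj_eq)
  show "f 0 = u" "f (length p) = v" using pawalk_verts_ends[OF p(2)] by (simp_all add: f_def)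
  show "inj_on f {..length p}"
    unfolding f_def using p(3) by (auto intro!: inj_on_nth simp: length_pawalk_verts)
  show nth: "p ! i = (f i, f (Suc i))" if "i < length p" for i
    unfolding f_def using nth_pcas[OF p(2) that] .
  show "(f i, f (Suc i)) \<in> parcs G" if "i < length p" for i
    using p(1) nth_mem[OF that] nth[OF that] by auto
qed

text \<open>Lets later proofs give a path as an explicit function on positions instead of a list of
  arcs. The hypothesis on \<open>u\<close> covers the path of length 0, for which the sequence says
  nothing about membership in \<open>G\<close>.\<close>

lemma proper_path_iff_sequence:
  assumes "u \<in> pverts G"
  shows "(\<exists>p. proper_path G c u p v) \<longleftrightarrow>
    (\<exists>f n. f 0 = u \<and> f n = v \<and> inj_on f {..n} \<and> (\<forall>i<n. (f i, f (Suc i)) \<in> parcs G) \<and>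
      (\<forall>i. Suc i < n \<longrightarrow> c {f i, f (Suc i)} \<noteq> c {f (Suc i), f (Suc (Suc i))}))"
    (is "?L \<longleftrightarrow> ?R")
proof
  assume ?L
  then obtain p where p: "pre_digraph.apath (with_proj G) u p v"
    "distinct_adj (map (\<lambda>(x, y). c {x, y}) p)"
    by (auto simp: proper_path_def)
  let ?f = "nth (pawalk_verts u p)"
  note f = apath_sequence[OF p(1)]
  have "c {?f i, ?f (Suc i)} \<noteq> c {?f (Suc i), ?f (Suc (Suc i))}"
    if "Suc i < length p" for i
    using p(2) that f(4)[of i] f(4)[of "Suc i"] by (auto simp: distinct_adj_conv_nth)
  then show ?R using f by blast
next
  assume ?R
  then obtain f n where f: "f 0 = u" "f n = v" "inj_on f {..n}"
    "\<And>i. i < n \<Longrightarrow> (f i, f (Suc i)) \<in> parcs G"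
    "\<And>i. Suc i < n \<Longrightarrow> c {f i, f (Suc i)} \<noteq> c {f (Suc i), f (Suc (Suc i))}"
    by blast
  have "proper_path G c u (map (\<lambda>i. (f i, f (Suc i))) [0..<n]) v"
    using f assms pcas_map_upt[of f 0 n] pawalk_verts_map_upt[of f 0 n]
    by (auto simp: proper_path_def pre_digraph.apath_def pre_digraph.awalk_def
        atLeast0LessThan lessThan_Suc_atMost
        cas_with_proj_eq awalk_verts_with_proj_eq distinct_map distinct_adj_conv_nth
        simp del: upt_Suc)
  then show ?L by blast
qed

text \<open>The arc relation is symmetric, so connectedness gives reachability in the directed
  sense, and a reachable vertex is reached by a path without repetitions.\<close>

lemma connected_sequence:
  assumes "nontrivial_connected_graph G" "u \<in> pverts G" "v \<in> pverts G"
  obtains f n where "f 0 = u" "f n = v" "inj_on f {..n}"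
    "\<forall>i<n. (f i, f (Suc i)) \<in> parcs G"
proof -
  interpret pair_graph G using assms(1) by (simp add: nontrivial_connected_graph_def)
  have "strongly_connected (with_proj G)"
    using assms(1) symmetric_connected_imp_strongly_connected pair_sym_arcs
    by (auto simp: nontrivial_connected_graph_def)
  then have "u \<rightarrow>\<^sup>*\<^bsub>with_proj G\<^esub> v" using assms by auto
  then obtain p where "apath u p v" by (auto simp: reachable_apath)
  from apath_sequence[OF this] show thesis
    by (intro that[of "nth (pawalk_verts u p)" "length p"]) simp_all
qed

section \<open>Optimal colourings, and when one colour suffices\<close>

lemma finite_edges_of:
  assumes "pair_graph G"
  shows "finite (edges_of G)"
  using pair_fin_digraph.pair_finite_arcs[of G] assms
  by (simp add: edges_of_def pair_graph_def pair_digraph_def)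

text \<open>If all edges have different colours, every path is proper: equal consecutive edges would
  force \<open>f i = f (i + 2)\<close>. This makes the minimum in \<open>pc\<close> range over a
  nonempty set.\<close>

lemma ex_proper_connected_coloring:
  assumes "nontrivial_connected_graph G"
  shows "\<exists>c. proper_connected_coloring G c"
proof -
  interpret pair_graph G using assms by (simp add: nontrivial_connected_graph_def)
  obtain c :: "'a set \<Rightarrow> nat" where c: "inj_on c (edges_of G)"
    using finite_imp_inj_to_nat_seg[OF finite_edges_of] pair_graph_axioms by blast
  have edge: "{x, y} \<in> edges_of G" if "(x, y) \<in> parcs G" for x y
    using that by (force simp: edges_of_def)
  have "\<exists>p. proper_path G c u p v" if uv: "u \<in> pverts G" "v \<in> pverts G" for u v
  proof -
    obtain f n where f: "f 0 = u" "f n = v" "inj_on f {..n}"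
      "\<And>i. i < n \<Longrightarrow> (f i, f (Suc i)) \<in> parcs G"
      using connected_sequence[OF assms uv] by metis
    have "c {f i, f (Suc i)} \<noteq> c {f (Suc i), f (Suc (Suc i))}" if "Suc i < n" for i
    proof
      assume "c {f i, f (Suc i)} = c {f (Suc i), f (Suc (Suc i))}"
      then have "{f i, f (Suc i)} = {f (Suc i), f (Suc (Suc i))}"
        using inj_onD[OF c] edge f(4) that by (meson Suc_lessD)
      then have "f i = f (Suc (Suc i))" by (auto simp: doubleton_eq_iff)
      then show False using inj_onD[OF f(3), of i "Suc (Suc i)"] that by simp
    qed
    then show ?thesis unfolding proper_path_iff_sequence[OF uv(1)] using f by blast
  qed
  then show ?thesis by (auto simp: proper_connected_coloring_def)
qed

lemma pc_le:
  assumes "proper_connected_coloring G c"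
  shows "pc G \<le> card (c ` edges_of G)"
  unfolding pc_def by (rule Least_le) (use assms in blast)

text \<open>The colouring \<open>c'\<close> serves only to show that the \<open>LEAST\<close> in
  \<open>pc\<close> is attained; \<open>c\<close> is an optimal colouring.\<close>

lemma pc_witness:
  assumes "proper_connected_coloring G c'"
  obtains c where "proper_connected_coloring G c" "card (c ` edges_of G) = pc G"
proof -
  have "\<exists>c. proper_connected_coloring G c \<and> card (c ` edges_of G) = pc G"
    unfolding pc_def by (rule LeastI) (use assms in blast)
  then show thesis using that by blast
qed

lemma obtain_distinct_elements:
  assumes "2 \<le> card A"
  obtains x y where "x \<in> A" "y \<in> A" "x \<noteq> y"
  using assms by (metis card_2_iff obtain_subset_with_card_n insert_subset)

lemma pc_ge_1:
  assumes "pair_graph G" "2 \<le> card (pverts G)" "proper_connected_coloring G c"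
  shows "1 \<le> pc G"
proof -
  obtain c where c: "proper_connected_coloring G c" "card (c ` edges_of G) = pc G"
    using pc_witness assms(3) .
  obtain u v where uv: "u \<in> pverts G" "v \<in> pverts G" "u \<noteq> v"
    using obtain_distinct_elements[OF assms(2)] .
  then obtain f n where f: "f 0 = u" "f n = v" "\<forall>i<n. (f i, f (Suc i)) \<in> parcs G"
    using c(1) proper_path_iff_sequence[of u G c v] by (auto simp: proper_connected_coloring_def)
  have "n \<noteq> 0" using f uv by (intro notI) auto
  then have "edges_of G \<noteq> {}" using f(3) by (auto simp: edges_of_def)
  then have "card (c ` edges_of G) > 0"
    using finite_edges_of[OF assms(1)] by (simp add: card_gt_0_iff)
  then show ?thesis using c(2) by simp
qed

definition complete_graph :: "'a pair_pre_digraph \<Rightarrow> bool" where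
  "complete_graph G \<longleftrightarrow> (\<forall>u \<in> pverts G. \<forall>v \<in> pverts G. u \<noteq> v \<longrightarrow> (u, v) \<in> parcs G)"

text \<open>With a single colour, no path of length 2 or more is proper, so joined vertices must be
  adjacent. Conversely, in a complete graph single edges join all pairs under a constant
  colouring.\<close>

lemma pc_eq_1_iff_complete:
  assumes "pair_graph G" "2 \<le> card (pverts G)" "proper_connected_coloring G c"
  shows "pc G = 1 \<longleftrightarrow> complete_graph G"
proof
  assume "pc G = 1"
  then obtain c where c: "proper_connected_coloring G c" "card (c ` edges_of G) = 1"
    using pc_witness assms(3) by metis
  from c(2) obtain k where k: "c ` edges_of G = {k}" by (auto simp: card_1_singleton_iff)
  have col: "c {x, y} = k" if "(x, y) \<in> parcs G" for x y
    using that k by (force simp: edges_of_def)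
  have "(u, v) \<in> parcs G" if uv: "u \<in> pverts G" "v \<in> pverts G" "u \<noteq> v" for u v
  proof -
    obtain f n where f: "f 0 = u" "f n = v" "\<And>i. i < n \<Longrightarrow> (f i, f (Suc i)) \<in> parcs G"
      "\<And>i. Suc i < n \<Longrightarrow> c {f i, f (Suc i)} \<noteq> c {f (Suc i), f (Suc (Suc i))}"
      using c(1) uv proper_path_iff_sequence[of u G c v]
      by (auto simp: proper_connected_coloring_def)
    have "n \<noteq> 0" using f uv by (intro notI) auto
    moreover have "\<not> Suc 0 < n" using f(3)[of 0] f(3)[of 1] f(4)[of 0] col by auto
    ultimately have "n = 1" by simp
    then show ?thesis using f(1,2) f(3)[of 0] by simp
  qed
  then show "complete_graph G" by (simp add: complete_graph_def)
next
  assume G: "complete_graph G"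
  have "\<exists>p. proper_path G (\<lambda>_. 0) u p v"
    if uv: "u \<in> pverts G" "v \<in> pverts G" "u \<noteq> v" for u v
    unfolding proper_path_iff_sequence[OF uv(1)] using uv G
    by (intro exI[of _ "\<lambda>i. if i = 0 then u else v"] exI[of _ 1])
      (auto simp: complete_graph_def inj_on_def)
  then have "proper_connected_coloring G (\<lambda>_. 0)"
    by (simp add: proper_connected_coloring_def)
  from pc_le[OF this] have "pc G \<le> card ((\<lambda>_. 0 :: nat) ` edges_of G)" .
  also have "\<dots> \<le> card {0 :: nat}" by (rule card_mono) auto
  finally show "pc G = 1" using pc_ge_1[OF assms] by simp
qed

section \<open>Arcs and completeness of the product\<close>

lemma arcs_lexicographic_product:
  "((g, h), (g', h')) \<in> parcs (lexicographic_product G H) \<longleftrightarrow>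
    g \<in> pverts G \<and> h \<in> pverts H \<and> g' \<in> pverts G \<and> h' \<in> pverts H \<and>
    ((g, g') \<in> parcs G \<or> g = g' \<and> (h, h') \<in> parcs H)"
  by (auto simp: lexicographic_product_def)

lemma pverts_lexicographic_product [simp]:
  "pverts (lexicographic_product G H) = pverts G \<times> pverts H"
  by (simp add: lexicographic_product_def)

text \<open>Each factor is read off from a copy of it in the product, with the other coordinate
  fixed at \<open>h\<^sub>0\<close> or \<open>g\<^sub>0\<close>. In the copy of \<open>H\<close>, an
  arc could otherwise come from a loop at \<open>g\<^sub>0\<close>, which \<open>irrefl\<close>
  excludes.\<close>

lemma complete_lexicographic_product_iff:
  assumes "pair_graph G" "pverts G \<noteq> {}" "pverts H \<noteq> {}"
  shows "complete_graph (lexicographic_product G H) \<longleftrightarrow> complete_graph G \<and> complete_graph H"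
proof -
  interpret G: pair_graph G by fact
  have irrefl: "(g, g) \<notin> parcs G" for g using G.no_loops' by auto
  obtain g\<^sub>0 h\<^sub>0 where gh: "g\<^sub>0 \<in> pverts G" "h\<^sub>0 \<in> pverts H" using assms(2,3) by auto
  show ?thesis (is "complete_graph ?L \<longleftrightarrow> _")
  proof
    assume L: "complete_graph ?L"
    have "(u, v) \<in> parcs G" if "u \<in> pverts G" "v \<in> pverts G" "u \<noteq> v" for u v
    proof -
      have "((u, h\<^sub>0), (v, h\<^sub>0)) \<in> parcs ?L" using L that gh by (simp add: complete_graph_def)
      then show ?thesis using that by (simp add: arcs_lexicographic_product)
    qed
    moreover have "(u, v) \<in> parcs H" if "u \<in> pverts H" "v \<in> pverts H" "u \<noteq> v" for u v
    proof -
      have "((g\<^sub>0, u), (g\<^sub>0, v)) \<in> parcs ?L" using L that gh by (simp add: complete_graph_def)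
      then show ?thesis using irrefl by (simp add: arcs_lexicographic_product)
    qed
    ultimately show "complete_graph G \<and> complete_graph H" by (simp add: complete_graph_def)
  next
    assume "complete_graph G \<and> complete_graph H"
    then show "complete_graph ?L"
      by (auto simp: complete_graph_def arcs_lexicographic_product)
  qed
qed

section \<open>The colouring of the product with two colours\<close>

text \<open>Counting the different bits among the ends gives colour 1 for agreeing and 2 for
  differing bits, and is defined on the unordered edge without naming its ends.\<close>

definition fibre_coloring :: "'b \<Rightarrow> ('a \<times> 'b) set \<Rightarrow> nat" where
  "fibre_coloring h0 e = card ((\<lambda>x. snd x = h0) ` e)"

lemma fibre_coloring_doubleton:
  "fibre_coloring h0 {x, y} = (if (snd x = h0) = (snd y = h0) then 1 else 2)"
  by (auto simp: fibre_coloring_def)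

text \<open>The parity of \<open>i div 2\<close> runs through the pattern with period 4 and changes
  exactly after odd \<open>i\<close>.\<close>

lemma alternating_bits:
  fixes i :: nat
  shows "(odd (i div 2) = odd (Suc i div 2)) = even i"
  by presburger

text \<open>Lifts a walk \<open>y\<close> in \<open>G\<close>. Assumption \<open>last\<close> says
  that \<open>h'\<close> has the bit that the pattern, started at the bit of \<open>h\<close>,
  prescribes at position \<open>n\<close>. Assumption \<open>rep\<close> restricts repetitions in
  \<open>y\<close> to positions two apart, where the bits differ, and to the two ends, where
  \<open>h\<close> and \<open>h'\<close> differ; so the lift repeats no vertex.\<close>

lemma proper_path_over_walk:
  assumes G: "pair_graph G"
    and h0: "h0 \<in> pverts H" "h1 \<in> pverts H" "h1 \<noteq> h0"
    and h: "h \<in> pverts H" "h' \<in> pverts H"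
    and y: "\<And>i. i < n \<Longrightarrow> (y i, y (Suc i)) \<in> parcs G" "n > 0"
    and last: "(h' = h0) = ((h = h0) \<noteq> odd (n div 2))"
    and rep: "\<And>i j. i < j \<Longrightarrow> j \<le> n \<Longrightarrow> y i = y j \<Longrightarrow> j = i + 2 \<or> i = 0 \<and> j = n \<and> h \<noteq> h'"
  shows "\<exists>p. proper_path (lexicographic_product G H) (fibre_coloring h0) (y 0, h) p (y n, h')"
proof -
  interpret G: pair_graph G by fact
  define bit where "bit i = ((h = h0) \<noteq> odd (i div 2))" for i :: nat
  \<comment> \<open>The ends keep their prescribed coordinates; inside, \<open>h0\<close> and
    \<open>h1\<close> represent the two values of the bit.\<close>
  define r where "r i = (if i = 0 then h else if i = n then h' else if bit i then h0 else h1)" for i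
  have bit: "(r i = h0) = bit i" for i
    using last h0 by (auto simp: r_def bit_def)
  have r_in: "r i \<in> pverts H" for i using h0 h by (simp add: r_def)
  have step: "(bit i = bit (Suc i)) = even i" for i
    using alternating_bits[of i] by (auto simp: bit_def)
  define f where "f i = (y i, r i)" for i
  have flip: "bit (i + 2) \<noteq> bit i" for i by (auto simp: bit_def)
  have ne: "f i \<noteq> f j" if ij: "i < j" "j \<le> n" for i j
  proof
    assume "f i = f j"
    then have eq: "y i = y j" "r i = r j" by (simp_all add: f_def)
    from rep[OF ij eq(1)] show False
    proof (elim disjE conjE)
      assume "j = i + 2"
      then show False using flip[of i] bit[of i] bit[of j] eq(2) by simp
    next
      assume "i = 0" "j = n" "h \<noteq> h'"
      then show False using eq(2) y(2) by (simp add: r_def)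
    qed
  qed
  have inj: "inj_on f {..n}"
    by (rule linorder_inj_onI) (use ne in auto)
  \<comment> \<open>Each step moves along an arc of \<open>G\<close>, so the product has the lifted
    arc whatever the second coordinates are.\<close>
  have arc: "(f i, f (Suc i)) \<in> parcs (lexicographic_product G H)" if "i < n" for i
    using y(1)[OF that] r_in by (auto simp: f_def arcs_lexicographic_product G.wellformed')
  have col: "fibre_coloring h0 {f i, f (Suc i)} = (if even i then 1 else 2)" for i
    by (simp add: fibre_coloring_doubleton f_def bit step)
  have ends: "f 0 = (y 0, h)" "f n = (y n, h')" using y(2) by (auto simp: f_def r_def)
  have start: "(y 0, h) \<in> pverts (lexicographic_product G H)"
    using y h(1) G.wellformed' by auto
  have "fibre_coloring h0 {f i, f (Suc i)} \<noteq>
      fibre_coloring h0 {f (Suc i), f (Suc (Suc i))}" for i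
    unfolding col by simp
  then show ?thesis
    unfolding proper_path_iff_sequence[OF start] using ends inj arc by blast
qed

lemma proper_connected_fibre_coloring:
  assumes G: "nontrivial_connected_graph G" and h0: "h0 \<in> pverts H" "h1 \<in> pverts H" "h1 \<noteq> h0"
  shows "proper_connected_coloring (lexicographic_product G H) (fibre_coloring h0)"
proof -
  interpret G: pair_graph G using G by (simp add: nontrivial_connected_graph_def)
  note path = proper_path_over_walk[OF G.pair_graph_axioms h0]
  have "\<exists>p. proper_path (lexicographic_product G H) (fibre_coloring h0) (g, h) p (g', h')"
    if g: "g \<in> pverts G" "g' \<in> pverts G" and h: "h \<in> pverts H" "h' \<in> pverts H"
      and ne: "(g, h) \<noteq> (g', h')" for g h g' h'
  proof (cases "g = g'")
    case True
    obtain w where w: "w \<in> pverts G" "w \<noteq> g"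
      using G by (metis obtain_distinct_elements nontrivial_connected_graph_def)
    \<comment> \<open>The first step of a path to another vertex supplies a neighbour
      \<open>z\<close> of \<open>g\<close>.\<close>
    obtain f n where f: "f 0 = g" "f n = w" "\<And>i. i < n \<Longrightarrow> (f i, f (Suc i)) \<in> parcs G"
      using connected_sequence[OF G g(1) w(1)] by metis
    have "n \<noteq> 0" using f w by (intro notI) auto
    then obtain z where z: "(g, z) \<in> parcs G" using f by fastforce
    then have z': "(z, g) \<in> parcs G" "z \<noteq> g"
      using G.arcs_symmetric G.no_loops' by auto
    let ?y = "\<lambda>i :: nat. if even i then g else z"
    \<comment> \<open>The walk alternates between \<open>g\<close> and \<open>z\<close>. After 2
      steps the bit is flipped, after 4 it is restored.\<close>
    define n :: nat where "n = (if (h = h0) = (h' = h0) then 4 else 2)"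
    \<comment> \<open>For \<open>n = 4\<close>, positions 0 and 4 carry the same vertex of
      \<open>G\<close> and the same bit; the lifts differ because \<open>h\<close> and
      \<open>h'\<close> do.\<close>
    have rep: "j = i + 2 \<or> i = 0 \<and> j = n \<and> h \<noteq> h'"
      if ij: "i < j" "j \<le> n" "?y i = ?y j" for i j
    proof -
      have "even i = even j" using ij(3) z'(2) by (auto split: if_splits)
      moreover have "n = 2 \<or> n = 4" by (simp add: n_def)
      ultimately have "j = i + 2 \<or> i = 0 \<and> j = n" using ij(1,2) by presburger
      then show ?thesis using ne True by auto
    qed
    have "\<exists>p. proper_path (lexicographic_product G H) (fibre_coloring h0) (?y 0, h) p (?y n, h')"
      by (rule path[OF h]) (use z z' rep in \<open>auto simp: n_def\<close>)
    then show ?thesis using True by (simp add: n_def split: if_splits)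
  next
    case False
    obtain f d where f: "f 0 = g" "f d = g'" "inj_on f {..d}"
      "\<And>i. i < d \<Longrightarrow> (f i, f (Suc i)) \<in> parcs G"
      using connected_sequence[OF G g] by metis
    have d: "d > 0" using f False by (intro gr0I) auto
    \<comment> \<open>The path is followed by one step back along its last edge and one forward
      again: positions \<open>d + 1\<close> and \<open>d + 2\<close> repeat \<open>d - 1\<close> and
      \<open>d\<close>. Since \<open>d > 0\<close>, the subtraction is not truncated there.\<close>
    define y where "y i = f (if i \<le> d then i else i - 2)" for i
    have arc: "(y i, y (Suc i)) \<in> parcs G" if i: "i < d + 2" for i
    proof -
      consider "i < d" | "i = d" | "i = Suc d" using i by linarith
      then show ?thesis
      proof cases
        case 2
        then show ?thesis using f(4)[of "d - 1"] d G.arcs_symmetric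
          by (auto simp: y_def numeral_2_eq_2)
      next
        case 3
        then show ?thesis using f(4)[of "d - 1"] d
          by (auto simp: y_def numeral_2_eq_2)
      qed (use f(4) in \<open>simp add: y_def\<close>)
    qed
    have rep: "j = i + 2" if "i < j" "j \<le> d + 2" "y i = y j" for i j
    proof -
      have "(if i \<le> d then i else i - 2) = (if j \<le> d then j else j - 2)"
        using inj_onD[OF f(3) that(3)[unfolded y_def]] that by auto
      then show ?thesis using that(1,2) d by (simp split: if_splits)
    qed
    \<comment> \<open>Both lengths end at \<open>g'\<close>, but with opposite bits, so one of them
      fits \<open>h'\<close>.\<close>
    obtain n where n: "n = d \<or> n = d + 2" "(h' = h0) = ((h = h0) \<noteq> odd (n div 2))"
    proof (cases "(h' = h0) = ((h = h0) \<noteq> odd (d div 2))")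
      case True
      then show ?thesis using that[of d] by simp
    next
      case False
      then show ?thesis using that[of "d + 2"] by auto
    qed
    have "\<exists>p. proper_path (lexicographic_product G H) (fibre_coloring h0) (y 0, h) p (y n, h')"
      by (rule path[OF h _ _ n(2)]) (use n(1) d arc rep in auto)
    moreover have "y 0 = g" "y n = g'" using n(1) f by (auto simp: y_def)
    ultimately show ?thesis by simp
  qed
  then show ?thesis by (auto simp: proper_connected_coloring_def)
qed

text \<open>The fibre colouring bounds the value by 2, and completeness of the factors decides
  whether it is 1.\<close>

lemma pc_lexicographic_product:
  assumes "nontrivial_connected_graph G" "nontrivial_connected_graph H"
  shows "pc (lexicographic_product G H) = (if pc G = 1 \<and> pc H = 1 then 1 else 2)"
proof -
  let ?L = "lexicographic_product G H"
  have G: "pair_graph G" "2 \<le> card (pverts G)" and H: "pair_graph H" "2 \<le> card (pverts H)"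
    using assms by (auto simp: nontrivial_connected_graph_def)
  obtain h0 h1 where h: "h0 \<in> pverts H" "h1 \<in> pverts H" "h1 \<noteq> h0"
    using obtain_distinct_elements[OF H(2)] by metis
  note c = proper_connected_fibre_coloring[OF assms(1) h]
  have L: "pair_graph ?L" by (rule pair_graph_lexicographic_product[OF G(1) H(1)])
  have "2 * 1 \<le> card (pverts G) * card (pverts H)"
    using G H by (intro mult_le_mono) auto
  then have L2: "2 \<le> card (pverts ?L)" by (simp add: card_cartesian_product)
  have "fibre_coloring h0 ` edges_of ?L \<subseteq> {1, 2}"
    by (auto simp: edges_of_def fibre_coloring_doubleton split: if_splits)
  from card_mono[OF _ this] have "card (fibre_coloring h0 ` edges_of ?L) \<le> 2" by simp
  with pc_le[OF c] have le: "pc ?L \<le> 2" by simp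
  have one: "pc G = 1 \<longleftrightarrow> complete_graph G" "pc H = 1 \<longleftrightarrow> complete_graph H"
    using pc_eq_1_iff_complete[OF G] pc_eq_1_iff_complete[OF H] ex_proper_connected_coloring assms
    by blast+
  have "pverts G \<noteq> {}" "pverts H \<noteq> {}" using G H by auto
  with pc_eq_1_iff_complete[OF L L2 c] one have "pc ?L = 1 \<longleftrightarrow> pc G = 1 \<and> pc H = 1"
    using complete_lexicographic_product_iff[OF G(1)] by simp
  then show ?thesis using le pc_ge_1[OF L L2 c] by auto
qed

section \<open>Stars, the examples for sharpness\<close>

definition star_graph :: "nat \<Rightarrow> nat pair_pre_digraph" where
  "star_graph n = \<lparr> pverts = {..n}, parcs = {0} \<times> {1..n} \<union> {1..n} \<times> {0} \<rparr>"

lemma star_graph_sel [simp]: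
  "pverts (star_graph n) = {..n}"
  "(x, y) \<in> parcs (star_graph n) \<longleftrightarrow> x = 0 \<and> y \<in> {1..n} \<or> y = 0 \<and> x \<in> {1..n}"
  by (auto simp: star_graph_def)

lemma pair_graph_star_graph: "pair_graph (star_graph n)"
  by unfold_locales (auto simp: star_graph_def symmetric_def sym_def)

lemma nontrivial_connected_star_graph:
  assumes "n \<ge> 1"
  shows "nontrivial_connected_graph (star_graph n)"
proof -
  let ?S = "star_graph n"
  interpret pair_graph ?S by (rule pair_graph_star_graph)
  have centre: "0 \<rightarrow>\<^sup>*\<^bsub>with_proj ?S\<^esub> v" "v \<rightarrow>\<^sup>*\<^bsub>with_proj ?S\<^esub> 0" if "v \<le> n" for v
    using that by (cases "v = 0"; auto intro!: reachable_adjI)+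
  have "Digraph_Component.connected (with_proj ?S)"
    by (rule connectedI)
      (use centre in \<open>auto intro: reachable_mk_symmetricI reachable_trans[of _ 0]\<close>)
  then show ?thesis using assms pair_graph_axioms by (simp add: nontrivial_connected_graph_def)
qed

text \<open>The maximum of an edge is its leaf, so \<open>Max\<close> gives all edges different
  colours. Fewer than \<open>n\<close> colours fail, since the only path between two leaves consists
  of their two edges.\<close>

lemma pc_star_graph:
  assumes "n \<ge> 1"
  shows "pc (star_graph n) = n"
proof (rule antisym)
  let ?S = "star_graph n"
  have edges: "edges_of ?S = (\<lambda>i. {0, i}) ` {1..n}"
    by (force simp: edges_of_def star_graph_def)
  have "\<exists>p. proper_path ?S Max u p v" if uv: "u \<le> n" "v \<le> n" "u \<noteq> v" for u v
  proof (cases "u = 0 \<or> v = 0")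
    case True
    then show ?thesis using uv
      by (intro iffD2[OF proper_path_iff_sequence] exI[of _ "\<lambda>i. if i = 0 then u else v"] exI[of _ 1])
        (auto simp: inj_on_def)
  next
    case False
    then show ?thesis using uv
      by (intro iffD2[OF proper_path_iff_sequence] exI[of _ "\<lambda>i. if i = 0 then u else if i = 1 then 0 else v"]
          exI[of _ 2])
        (auto simp: inj_on_def less_2_cases_iff atMost_Suc numeral_2_eq_2)
  qed
  then have "proper_connected_coloring ?S Max"
    by (auto simp: proper_connected_coloring_def)
  then have "pc ?S \<le> card (Max ` edges_of ?S)" by (rule pc_le)
  also have "Max ` edges_of ?S = {1..n}" unfolding edges image_image by auto
  finally show "pc ?S \<le> n" by simp
  obtain c where c: "proper_connected_coloring ?S c" "card (c ` edges_of ?S) = pc ?S"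
    using pc_witness ex_proper_connected_coloring[OF nontrivial_connected_star_graph[OF assms]]
    by metis
  have "c {0, u} \<noteq> c {0, v}" if uv: "u \<in> {1..n}" "v \<in> {1..n}" "u \<noteq> v" for u v
  proof -
    obtain f m where f: "f 0 = u" "f m = v" "inj_on f {..m}"
      "\<And>i. i < m \<Longrightarrow> (f i, f (Suc i)) \<in> parcs ?S"
      "\<And>i. Suc i < m \<Longrightarrow> c {f i, f (Suc i)} \<noteq> c {f (Suc i), f (Suc (Suc i))}"
      using c(1) uv proper_path_iff_sequence[of u ?S c v]
      by (auto simp: proper_connected_coloring_def)
    have m0: "0 < m" using f uv by (intro gr0I) auto
    then have f1: "f 1 = 0" using f(4)[of 0] f(1) uv by auto
    then have "m \<noteq> 1" using f(2) uv by auto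
    with m0 have m1: "1 < m" by simp
    then have f2: "f 2 \<noteq> 0" using f(4)[of 1] f1 by (auto simp: numeral_2_eq_2)
    \<comment> \<open>A third step would lead from the leaf \<open>f 2\<close> back to the centre,
      already visited at position 1.\<close>
    have "\<not> 2 < m"
    proof
      assume "2 < m"
      then have "f 3 = f 1" using f(4)[of 2] f1 f2 by (auto simp: numeral_3_eq_3)
      then show False using inj_onD[OF f(3), of 3 1] \<open>2 < m\<close> by simp
    qed
    with m1 have "m = 2" by simp
    then show ?thesis using f(1,2) f(5)[of 0] f1 by (simp add: numeral_2_eq_2 insert_commute)
  qed
  then have "inj_on (\<lambda>i. c {0, i}) {1..n}" by (meson inj_onI)
  from card_image[OF this] show "n \<le> pc ?S"
    using c(2) by (simp add: edges image_image)
qed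

text \<open>Every bound follows from the exact value of the product. Sharpness is claimed for the
  first and third bounds of (i): in the second, \<open>pc G + 1\<close> is at least 3 while the
  product has value 2, so equality never occurs.\<close>

theorem theorem2:
  shows "(\<forall>(G :: 'a pair_pre_digraph) (H :: 'b pair_pre_digraph).
      nontrivial_connected_graph G \<and> nontrivial_connected_graph H \<longrightarrow>
        (pc G \<ge> 2 \<and> pc H \<ge> 2 \<longrightarrow>
           (pc G > pc H \<longrightarrow> pc (lexicographic_product G H) \<le> pc H) \<and>
           (pc G < pc H \<longrightarrow> pc (lexicographic_product G H) \<le> pc G + 1) \<and>
           (pc G = pc H \<longrightarrow> pc (lexicographic_product G H) \<le> pc G)) \<and>
        (pc G = 1 \<and> pc H \<ge> 2 \<longrightarrow> pc (lexicographic_product G H) = 2) \<and>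
        (pc H = 1 \<and> pc G \<ge> 2 \<longrightarrow> pc (lexicographic_product G H) = 2) \<and>
        (pc G = 1 \<and> pc H = 1 \<longrightarrow> pc (lexicographic_product G H) = 1))
    \<and> (\<exists>(G :: nat pair_pre_digraph) (H :: nat pair_pre_digraph).
        nontrivial_connected_graph G \<and> nontrivial_connected_graph H \<and>
        pc G \<ge> 2 \<and> pc H \<ge> 2 \<and> pc G > pc H \<and> pc (lexicographic_product G H) = pc H)
    \<and> (\<exists>(G :: nat pair_pre_digraph) (H :: nat pair_pre_digraph).
        nontrivial_connected_graph G \<and> nontrivial_connected_graph H \<and>
        pc G \<ge> 2 \<and> pc H \<ge> 2 \<and> pc G = pc H \<and> pc (lexicographic_product G H) = pc G)"
proof -
  have star: "nontrivial_connected_graph (star_graph 2)" "nontrivial_connected_graph (star_graph 3)"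
    "pc (star_graph 2) = 2" "pc (star_graph 3) = 3"
    by (simp_all add: nontrivial_connected_star_graph pc_star_graph)
  show ?thesis
  proof (intro conjI)
    show "\<exists>(G :: nat pair_pre_digraph) (H :: nat pair_pre_digraph).
        nontrivial_connected_graph G \<and> nontrivial_connected_graph H \<and>
        pc G \<ge> 2 \<and> pc H \<ge> 2 \<and> pc G > pc H \<and> pc (lexicographic_product G H) = pc H"
      by (rule exI[of _ "star_graph 3"], rule exI[of _ "star_graph 2"])
        (simp add: star pc_lexicographic_product)
    show "\<exists>(G :: nat pair_pre_digraph) (H :: nat pair_pre_digraph).
        nontrivial_connected_graph G \<and> nontrivial_connected_graph H \<and>
        pc G \<ge> 2 \<and> pc H \<ge> 2 \<and> pc G = pc H \<and> pc (lexicographic_product G H) = pc G"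
      by (rule exI[of _ "star_graph 2"], rule exI[of _ "star_graph 2"])
        (simp add: star pc_lexicographic_product)
  qed (auto simp: pc_lexicographic_product)
qed

end
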